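(* Assume that $\|u_0\|_2\le M_u$, that $\mathcal{X}\subset\mathbb{R}^d$ is bounded in $\|\cdot\|_2$ by $M_X$, that $k>4d$, and that the prior $\pi_u$ is regular: there exist $C_1>0$, $C_2>0$ and $\kappa>0$ such that $\pi_u(B(u^*,\epsilon))\ge C_1\exp(-C_2\epsilon^{-\kappa})$ for all $\epsilon>0$ and every $u^*\in U$ minimizing $R$ over $U$, where $B(u^*,\epsilon)$ is the ball of radius $\epsilon$ centered at $u^*$. Let $\beta$ be a positive number satisfying $$\beta<\min\left\{1-2\sqrt{d/k},\ \frac{1}{1+\kappa}\right\}.$$ Then the Bayesian linear regression estimator $$\hat u=\int u\cdot p_D(u\mid\{Y_i\}_{i=1}^n)\,du$$ achieves learning rate $n^{-\beta}$; that is, for every $\delta\in(0,1)$ there exist $c>0$ and $N>0$ such that for all $n\ge N$, with probability at least $1-\delta$, $$R(\hat u)\le R(u_0)+c\,n^{-\beta}.$$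
   Context: Linear regression setting: $Y_i=\mathbf{X}_iu_0+\epsilon_i$, $i=1,\dots,n$, where $Y_i\in\mathbb{R}$, $\mathbf{X}_i\in\mathcal{X}\subset\mathbb{R}^d$ (row vectors), $u_0\in\mathbb{R}^d$, and the $\epsilon_i$ are i.i.d. random variables following a t-distribution with $k$ degrees of freedom. The pairs $(\mathbf{X}_i,Y_i)$ are i.i.d. copies of $(\mathbf{X},Y)$, and the errors are independent of the covariates. The prior $\pi_u$ is a proper (probability) distribution on a bounded set $U\subset\mathbb{R}^d$ with $u_0\in U$ ($U$ is the hypothesis class, $u$ being identified with the predictor $x\mapsto xu$). The posterior, computed as if the errors were standard normal, is the probability distribution $$p_D(u\mid\{Y_i\}_{i=1}^n)\propto\pi_u\exp\left\{\sum_{i=1}^n-\frac{(Y_i-\mathbf{X}_iu)^2}{2}\right\}.$$ The loss is $\ell(Y,\mathbf{X},u)=(Y-\mathbf{X}u)^2$ and the risk is $R(u)=\mathbb{E}[(Y-\mathbf{X}u)^2]$, so that $u_0$ minimizes $R$. Achieving learning rate $n^{-\beta}$ means that the risk of the estimator equals the optimal risk plus $\mathcal{O}(n^{-\beta})$ with probability at least $1-\delta$, for every $\delta\in(0,1)$. *)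

theory Defs
  imports "HOL-Probability.Probability"
begin

definition student_t_density :: "real \<Rightarrow> real \<Rightarrow> real" where
  "student_t_density k t =
     Gamma ((k + 1) / 2) / (sqrt (k * pi) * Gamma (k / 2)) * (1 + t\<^sup>2 / k) powr (- (k + 1) / 2)"

text \<open>The library's \<open>indep_var\<close> requires both variables to have the same type; this is its
  characterisation \<open>indep_var_eq\<close> for variables of different types, with \<open>sigma_sets\<close> omitted
  because the preimages already form a sigma-algebra.\<close>

definition indep_rvs ::
  "'w measure \<Rightarrow> ('w \<Rightarrow> 'a::topological_space) \<Rightarrow> ('w \<Rightarrow> 'b::topological_space) \<Rightarrow> bool" where
  "indep_rvs M X Z \<longleftrightarrow> X \<in> borel_measurable M \<and> Z \<in> borel_measurable M \<and>
     prob_space.indep_set M {X -` A \<inter> space M | A. A \<in> sets borel}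
                            {Z -` B \<inter> space M | B. B \<in> sets borel}"

definition sq_loss :: "real \<Rightarrow> real ^ 'd \<Rightarrow> real ^ 'd \<Rightarrow> real" where
  "sq_loss y x u = (y - x \<bullet> u)\<^sup>2"

definition risk ::
  "'w measure \<Rightarrow> ('w \<Rightarrow> real ^ 'd) \<Rightarrow> ('w \<Rightarrow> real) \<Rightarrow> real ^ 'd \<Rightarrow> real" where
  "risk M X Y u = (\<integral>\<omega>. sq_loss (Y \<omega>) (X \<omega>) u \<partial>M)"

text \<open>The prior is a measure on the whole space; being a distribution on \<open>U\<close> is expressed
  separately, so \<open>U\<close> itself need not be measurable.\<close>

definition regular_prior ::
  "(real ^ 'd \<Rightarrow> real) \<Rightarrow> (real ^ 'd) set \<Rightarrow> (real ^ 'd) measure \<Rightarrow> real \<Rightarrow> bool" where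
  "regular_prior R U prior \<kappa> \<longleftrightarrow>
     (\<exists>C1>0. \<exists>C2>0. \<forall>\<epsilon>>0. \<forall>u\<in>U. (\<forall>v\<in>U. R u \<le> R v) \<longrightarrow>
        measure prior (ball u \<epsilon>) \<ge> C1 * exp (- C2 * \<epsilon> powr (- \<kappa>)))"

text \<open>Unnormalised Gaussian likelihood of the sample with indices \<open>1, \<dots>, n\<close>.\<close>

definition gauss_likelihood ::
  "(nat \<Rightarrow> real ^ 'd) \<Rightarrow> (nat \<Rightarrow> real) \<Rightarrow> nat \<Rightarrow> real ^ 'd \<Rightarrow> real" where
  "gauss_likelihood x y n u = exp (\<Sum>i=1..n. - (sq_loss (y i) (x i) u / 2))"

text \<open>The likelihood takes values in \<open>(0, 1]\<close>, so for a probability measure \<open>prior\<close> the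
  normalising constant lies in \<open>(0, 1]\<close> and the posterior is again a probability measure.\<close>

definition posterior ::
  "(real ^ 'd) measure \<Rightarrow> (nat \<Rightarrow> real ^ 'd) \<Rightarrow> (nat \<Rightarrow> real) \<Rightarrow> nat \<Rightarrow> (real ^ 'd) measure" where
  "posterior prior x y n =
     density prior (\<lambda>u. ennreal (gauss_likelihood x y n u / (\<integral>v. gauss_likelihood x y n v \<partial>prior)))"

definition posterior_mean ::
  "(real ^ 'd) measure \<Rightarrow> (nat \<Rightarrow> real ^ 'd) \<Rightarrow> (nat \<Rightarrow> real) \<Rightarrow> nat \<Rightarrow> real ^ 'd" where
  "posterior_mean prior x y n = (\<integral>u. u \<partial>posterior prior x y n)"

end

theory Submission imports Defs begin

text \<open>
  Why the theorem holds. Since the noise is centred and uncorrelated with the covariates,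
  the excess risk is a quadratic form, \<open>R u = R u0 + q (u - u0)\<close> with
  \<open>q v = E (X \<bullet> v)\<^sup>2\<close>. By convexity of \<open>q\<close> the excess risk of the posterior mean is at most
  the posterior expectation of \<open>q (u - u0)\<close>, so it suffices to bound the latter.

  Up to a factor that does not depend on \<open>u\<close>, the likelihood at \<open>u = u0 + v\<close> is
  \<open>exp (S \<bullet> v - (\<Sum>i. (X\<^sub>i \<bullet> v)\<^sup>2) / 2)\<close> with the noise vector \<open>S = \<Sum>i. \<epsilon>\<^sub>i X\<^sub>i\<close>.
  Suppose that the sample satisfies, for all \<open>v\<close> simultaneously,
  \<open>(\<Sum>i. (X\<^sub>i \<bullet> v)\<^sup>2) \<ge> n q v / 2\<close> and \<open>(S \<bullet> v)\<^sup>2 \<le> A n q v\<close>. Then the inequality of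
  arithmetic and geometric means absorbs the linear term into the quadratic one, at a cost that
  does not grow with \<open>n\<close>, and the likelihood ratio is at most \<open>exp (2 A - n q v / 8)\<close>. A density
  with this decay concentrates where \<open>q\<close> is at most of order \<open>(1 - ln Z) / n\<close>, with \<open>Z\<close> the
  normalising constant (\<open>tilted_expectation_le\<close>). The regularity of the prior bounds \<open>Z\<close>
  from below: on the ball of radius \<open>\<epsilon>\<close> around \<open>u0\<close> the likelihood ratio is at least
  \<open>exp (- O(1 + n \<epsilon>\<^sup>2))\<close>, so \<open>- ln Z = O(1 + \<epsilon> powr (-\<kappa>) + n \<epsilon>\<^sup>2)\<close>. With
  \<open>\<epsilon> = n powr (-\<beta>/2)\<close> the last term is of order \<open>n powr (1-\<beta>)\<close>, and \<open>\<beta> < 1 / (1 + \<kappa>)\<close> makes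
  \<open>\<epsilon> powr (-\<kappa>)\<close> no larger; division by \<open>n\<close> gives the rate (\<open>tilted_mean_bound\<close>,
  \<open>rate_arithmetic\<close>).

  The two conditions on the sample hold with probability at least \<open>1 - \<delta>\<close> because they follow from
  a bound of order \<open>n\<close> on one nonnegative random variable, \<open>fluctuation\<close>: the sum of the squared
  centred entries of \<open>\<Sum>i. X\<^sub>i X\<^sub>i\<^sup>T\<close> and of the squared entries of \<open>S\<close>. All of these entries are sums
  of independent centred variables with bounded variances, so the expectation of
  \<open>fluctuation\<close> is of order \<open>n\<close> and Markov's inequality applies. The form \<open>q\<close> may be degenerate, which
  is why entrywise control does not compare with \<open>q\<close> directly. But the covariates almost surely lie in
  the orthogonal complement of the kernel of \<open>q\<close>, and there \<open>q\<close> dominates a multiple of the squared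
  norm (\<open>coercive_modulo_kernel\<close>).
\<close>

section \<open>Moments of Student's t distribution\<close>

lemma student_t_density_nonneg:
  assumes "k > 0" shows "student_t_density k t \<ge> 0"
  using assms unfolding student_t_density_def
  by (intro mult_nonneg_nonneg divide_nonneg_nonneg less_imp_le[OF Gamma_real_pos]) auto

lemma student_t_density_uminus [simp]: "student_t_density k (- t) = student_t_density k t"
  by (simp add: student_t_density_def)

lemma borel_measurable_student_t_density [measurable]:
  "student_t_density k \<in> borel_measurable borel"
  unfolding student_t_density_def[abs_def] by measurable

lemma integrable_Cauchy_kernel: "integrable lborel (\<lambda>t::real. 1 / (1 + t\<^sup>2))"
  using integrable_inverse_1_plus_square
  by (simp add: set_integrable_def inverse_eq_divide)

text \<open>For \<open>k \<ge> 3\<close> the density times \<open>t\<^sup>2\<close> still decays at least as fast as the Cauchy density, so a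
  rescaled Cauchy kernel dominates it.\<close>

lemma student_t_second_moment:
  assumes k: "k \<ge> 3"
  shows "integrable lborel (\<lambda>t. student_t_density k t * t\<^sup>2)"
proof -
  define c where "c = Gamma ((k + 1) / 2) / (sqrt (k * pi) * Gamma (k / 2))"
  have c0: "c \<ge> 0" unfolding c_def using k
    by (intro mult_nonneg_nonneg divide_nonneg_nonneg less_imp_le[OF Gamma_real_pos]) auto
  have "integrable lborel (\<lambda>t. 1 / (1 + (0 + (1 / sqrt k) * t)\<^sup>2))"
    using lborel_integrable_real_affine[OF integrable_Cauchy_kernel, of "1 / sqrt k" 0] k by simp
  then have "integrable lborel (\<lambda>t. 1 / (1 + t\<^sup>2 / k))"
    using k by (simp add: power_mult_distrib power_divide)
  then have dom: "integrable lborel (\<lambda>t. c * k * (1 / (1 + t\<^sup>2 / k)))"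
    by (rule integrable_mult_right)
  show ?thesis
  proof (rule Bochner_Integration.integrable_bound[OF dom], simp, intro AE_I2)
    fix t :: real
    define s where "s = 1 + t\<^sup>2 / k"
    have s: "s \<ge> 1" using k by (simp add: s_def)
    have t2: "t\<^sup>2 \<le> k * s" using k by (simp add: s_def field_simps)
    have "s powr (- (k + 1) / 2) * t\<^sup>2 \<le> s powr (- 2) * (k * s)"
      using s k t2 by (intro mult_mono powr_mono) auto
    also have "\<dots> = k * (1 / s)" using s by (simp add: powr_minus powr_numeral power2_eq_square field_simps)
    finally have "c * (s powr (- (k + 1) / 2) * t\<^sup>2) \<le> c * (k * (1 / s))"
      using c0 by (rule mult_left_mono)
    moreover have "student_t_density k t = c * s powr (- (k + 1) / 2)"
      by (simp add: student_t_density_def c_def s_def)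
    ultimately show "norm (student_t_density k t * t\<^sup>2) \<le> norm (c * k * (1 / (1 + t\<^sup>2 / k)))"
      using c0 k s by (simp add: s_def[symmetric] abs_mult mult.assoc)
  qed
qed

lemma student_t_mean_zero: "(\<integral>t. student_t_density k t * t \<partial>lborel) = 0"
  using lborel_integral_real_affine[of "-1" "\<lambda>t. student_t_density k t * t" 0] by simp

section \<open>Independence and second moments\<close>

text \<open>Composing one of the variables with a map into the value type of the other turns independence of
  differently typed variables into the same-type notion, for which expectations of products
  are known to factor.\<close>

lemma (in prob_space) indep_rvs_compose:
  fixes Z :: "'a \<Rightarrow> 'c::topological_space" and f :: "'b::topological_space \<Rightarrow> 'c"
  assumes "indep_rvs M X Z" and f[measurable]: "f \<in> borel_measurable borel"
  shows "indep_var borel (\<lambda>\<omega>. f (X \<omega>)) borel Z"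
proof -
  have [measurable]: "X \<in> borel_measurable M" "Z \<in> borel_measurable M"
    and ind: "indep_set {X -` A \<inter> space M | A. A \<in> sets borel} {Z -` B \<inter> space M | B. B \<in> sets borel}"
    using assms(1) by (auto simp: indep_rvs_def)
  have sub: "{(\<lambda>\<omega>. f (X \<omega>)) -` A \<inter> space M | A. A \<in> sets borel}
      \<subseteq> {X -` A \<inter> space M | A. A \<in> sets borel}"
  proof safe
    fix A :: "'c set" assume "A \<in> sets borel"
    then have "f -` A \<in> sets borel" using measurable_sets[OF f, of A] by simp
    then show "\<exists>B. (\<lambda>\<omega>. f (X \<omega>)) -` A \<inter> space M = X -` B \<inter> space M \<and> B \<in> sets borel"
      by (intro exI[of _ "f -` A"]) auto
  qed
  have ind': "indep_set {(\<lambda>\<omega>. f (X \<omega>)) -` A \<inter> space M | A. A \<in> sets borel}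
      {Z -` B \<inter> space M | B. B \<in> sets borel}"
  proof (rule indep_setI)
    show "{(\<lambda>\<omega>. f (X \<omega>)) -` A \<inter> space M | A. A \<in> sets borel} \<subseteq> events"
      using sub indep_setD_ev1[OF ind] by (rule order_trans)
    show "{Z -` B \<inter> space M | B. B \<in> sets borel} \<subseteq> events"
      by (rule indep_setD_ev2[OF ind])
  qed (rule indep_setD[OF ind subsetD[OF sub]])
  have stable: "Int_stable {g -` A \<inter> space M | A. A \<in> sets borel}"
    for g :: "'a \<Rightarrow> 'c"
  proof (safe intro!: Int_stableI)
    fix A B :: "'c set" assume "A \<in> sets borel" "B \<in> sets borel"
    then show "\<exists>C. g -` A \<inter> space M \<inter> (g -` B \<inter> space M) = g -` C \<inter> space M \<and> C \<in> sets borel"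
      by (intro exI[of _ "A \<inter> B"]) auto
  qed
  show ?thesis
    unfolding indep_var_eq using indep_set_sigma_sets[OF ind' stable stable] by simp
qed

text \<open>Off-diagonal terms of the squared sum vanish, so second moments add up. Hence sums of \<open>n\<close>
  identically distributed terms have size of order \<open>sqrt n\<close>, which is the
  concentration behind the bound on the fluctuation below.\<close>

lemma (in prob_space) second_moment_indep_sum:
  fixes Z :: "nat \<Rightarrow> 'a \<Rightarrow> real"
  assumes ind: "indep_vars (\<lambda>_. borel) Z I" and "finite I"
    and Z2: "\<And>i. i \<in> I \<Longrightarrow> integrable M (\<lambda>\<omega>. (Z i \<omega>)\<^sup>2)"
    and mean: "\<And>i. i \<in> I \<Longrightarrow> expectation (Z i) = 0"
  shows "integrable M (\<lambda>\<omega>. (\<Sum>i\<in>I. Z i \<omega>)\<^sup>2)"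
    and "expectation (\<lambda>\<omega>. (\<Sum>i\<in>I. Z i \<omega>)\<^sup>2) = (\<Sum>i\<in>I. expectation (\<lambda>\<omega>. (Z i \<omega>)\<^sup>2))"
proof -
  have meas: "i \<in> I \<Longrightarrow> Z i \<in> borel_measurable M" for i
    using ind by (auto simp: indep_vars_def)
  have Z1: "i \<in> I \<Longrightarrow> integrable M (Z i)" for i
    using square_integrable_imp_integrable[OF meas Z2] by blast
  have cross: "integrable M (\<lambda>\<omega>. Z i \<omega> * Z j \<omega>) \<and>
      expectation (\<lambda>\<omega>. Z i \<omega> * Z j \<omega>) = (if j = i then expectation (\<lambda>\<omega>. (Z i \<omega>)\<^sup>2) else 0)"
    if "i \<in> I" "j \<in> I" for i j
  proof (cases "i = j")
    case True then show ?thesis using Z2[OF \<open>i \<in> I\<close>] by (simp add: power2_eq_square)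
  next
    case False
    have iv: "indep_vars (\<lambda>_. borel) Z {i, j}"
      using indep_vars_subset[OF ind] that by simp
    show ?thesis
      using indep_vars_lebesgue_integral[OF _ iv] indep_vars_integrable[OF _ iv] False Z1 that mean
      by auto
  qed
  have sq: "(\<lambda>\<omega>. (\<Sum>i\<in>I. Z i \<omega>)\<^sup>2) = (\<lambda>\<omega>. \<Sum>i\<in>I. \<Sum>j\<in>I. Z i \<omega> * Z j \<omega>)"
    by (simp add: power2_eq_square sum_product)
  show "integrable M (\<lambda>\<omega>. (\<Sum>i\<in>I. Z i \<omega>)\<^sup>2)"
    unfolding sq using cross by auto
  show "expectation (\<lambda>\<omega>. (\<Sum>i\<in>I. Z i \<omega>)\<^sup>2) = (\<Sum>i\<in>I. expectation (\<lambda>\<omega>. (Z i \<omega>)\<^sup>2))"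
    unfolding sq using cross \<open>finite I\<close> by (simp add: sum.delta)
qed

section \<open>The second moment form of a bounded covariate\<close>

definition second_moment_form :: "'a::euclidean_space measure \<Rightarrow> 'a \<Rightarrow> real" where
  "second_moment_form P v = (\<integral>x. (x \<bullet> v)\<^sup>2 \<partial>P)"

lemma inner_square_expand:
  fixes x v :: "'a::euclidean_space"
  shows "(x \<bullet> v)\<^sup>2 = (\<Sum>a\<in>Basis. \<Sum>b\<in>Basis. ((x \<bullet> a) * (x \<bullet> b)) * ((v \<bullet> a) * (v \<bullet> b)))"
  unfolding power2_eq_square
  by (subst (1 2) euclidean_inner) (simp add: sum_product mult_ac)

text \<open>The locale serves for the covariate distribution, the prior and the posterior alike.\<close>

locale bounded_law = prob_space P for P :: "'a::euclidean_space measure" +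
  fixes b :: real
  assumes sets_P [measurable_cong]: "sets P = sets borel"
    and bounded: "AE x in P. norm x \<le> b"
begin

lemma integrable_inner_mult: "integrable P (\<lambda>x. (x \<bullet> v) * (x \<bullet> w))"
proof (rule integrable_const_bound[where B = "b * norm v * (b * norm w)"])
  show "AE x in P. norm ((x \<bullet> v) * (x \<bullet> w)) \<le> b * norm v * (b * norm w)"
    using bounded
  proof eventually_elim
    case (elim x)
    have "norm (x \<bullet> v) \<le> b * norm v" for v
      using Cauchy_Schwarz_ineq2[of x v] mult_right_mono[OF elim, of "norm v"] by simp
    from mult_mono[OF this this, of v w] show ?case
      using order_trans[OF norm_ge_zero elim] by (simp add: abs_mult)
  qed
qed measurable

lemma integrable_inner_square: "integrable P (\<lambda>x. (x \<bullet> v)\<^sup>2)"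
  using integrable_inner_mult[of v v] by (simp add: power2_eq_square)

lemma second_moment_form_expand:
  "second_moment_form P v =
     (\<Sum>a\<in>Basis. \<Sum>c\<in>Basis. (\<integral>x. (x \<bullet> a) * (x \<bullet> c) \<partial>P) * ((v \<bullet> a) * (v \<bullet> c)))"
  unfolding second_moment_form_def inner_square_expand[of _ v]
  by (simp add: integrable_inner_mult)

lemma continuous_second_moment_form: "continuous_on A (second_moment_form P)"
  unfolding second_moment_form_expand[abs_def] by (intro continuous_intros)

lemma second_moment_form_nonneg: "second_moment_form P v \<ge> 0"
  by (simp add: second_moment_form_def)

lemma second_moment_form_le: "second_moment_form P v \<le> b\<^sup>2 * (norm v)\<^sup>2"
proof -
  have "second_moment_form P v \<le> (\<integral>x. b\<^sup>2 * (norm v)\<^sup>2 \<partial>P)"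
    unfolding second_moment_form_def
  proof (rule integral_mono_AE[OF integrable_inner_square])
    show "AE x in P. (x \<bullet> v)\<^sup>2 \<le> b\<^sup>2 * (norm v)\<^sup>2" using bounded
    proof eventually_elim
      case (elim x)
      have "\<bar>x \<bullet> v\<bar> \<le> b * norm v"
        using Cauchy_Schwarz_ineq2[of x v] mult_right_mono[OF elim, of "norm v"] by simp
      then show ?case by (metis abs_ge_zero power2_abs power_mono power_mult_distrib)
    qed
  qed simp
  then show ?thesis by (simp add: prob_space)
qed

lemma second_moment_form_scale: "second_moment_form P (c *\<^sub>R v) = c\<^sup>2 * second_moment_form P v"
  by (simp add: second_moment_form_def power_mult_distrib)

lemma second_moment_form_eq_0_iff:
  "second_moment_form P v = 0 \<longleftrightarrow> (AE x in P. x \<bullet> v = 0)"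
  unfolding second_moment_form_def
  by (subst integral_nonneg_eq_0_iff_AE) (auto simp: integrable_inner_square)

text \<open>The vector \<open>p v\<close> is the component of \<open>v\<close> orthogonal to the kernel of the form. On the kernel
  \<open>x \<bullet> v\<close> vanishes almost surely, and since the kernel is spanned by finitely many vectors this happens for all
  its elements outside one null set. On the orthogonal complement the form is positive definite, so
  it attains a positive minimum on the compact unit sphere.\<close>

lemma coercive_modulo_kernel:
  obtains p c where "c > 0" "AE x in P. \<forall>v. x \<bullet> p v = x \<bullet> v"
    "\<And>v. (norm (p v))\<^sup>2 \<le> c * second_moment_form P v"
proof -
  define K where "K = {v. second_moment_form P v = 0}"
  have K: "subspace K"
    unfolding subspace_def K_def by (auto simp: second_moment_form_eq_0_iff inner_add_right)
  obtain B where B: "B \<subseteq> K" "finite B" "span B = K"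
    using basis_exists[of K] K by (metis finiteI_independent span_subspace)
  have "AE x in P. \<forall>v\<in>B. x \<bullet> v = 0"
    using B unfolding K_def second_moment_form_eq_0_iff by (subst AE_finite_all) auto
  then have orthK: "AE x in P. \<forall>v\<in>K. x \<bullet> v = 0"
  proof eventually_elim
    case (elim x)
    have "subspace {v. x \<bullet> v = 0}" by (simp add: subspace_def inner_add_right)
    then have "span B \<subseteq> {v. x \<bullet> v = 0}" using elim by (intro span_minimal) auto
    then show ?case using B by auto
  qed
  have "\<exists>z. v - z \<in> K \<and> (\<forall>w\<in>K. z \<bullet> w = 0)" for v
    using orthogonal_subspace_decomp_exists[of K v] K
    by (metis add_diff_cancel_right' orthogonal_def span_eq_iff)
  then obtain p where p: "\<And>v. v - p v \<in> K" "\<And>v w. w \<in> K \<Longrightarrow> p v \<bullet> w = 0" by metis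
  have AEp: "AE x in P. \<forall>v. x \<bullet> p v = x \<bullet> v"
    using orthK
  proof eventually_elim
    case (elim x)
    have "x \<bullet> p v = x \<bullet> v" for v
      using elim[rule_format, OF p(1)[of v]] by (simp add: inner_diff_right)
    then show ?case by blast
  qed
  define S where "S = sphere 0 1 \<inter> (\<Inter>w\<in>K. {z. z \<bullet> w = 0})"
  have "compact S" unfolding S_def
    by (intro compact_Int_closed compact_sphere closed_INT ballI closed_Collect_eq continuous_intros)
  have "\<exists>m>0. \<forall>z\<in>S. m \<le> second_moment_form P z"
  proof (cases "S = {}")
    case False
    then obtain z where z: "z \<in> S" "\<And>y. y \<in> S \<Longrightarrow> second_moment_form P z \<le> second_moment_form P y"
      using continuous_attains_inf[OF \<open>compact S\<close> False continuous_second_moment_form] by blast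
    have "z \<notin> K" using z(1) unfolding S_def by force
    then have "second_moment_form P z > 0"
      using second_moment_form_nonneg[of z] by (auto simp: K_def less_le)
    then show ?thesis using z by blast
  qed (auto intro: exI[of _ 1])
  then obtain m where m: "m > 0" "\<And>z. z \<in> S \<Longrightarrow> m \<le> second_moment_form P z" by blast
  have "(norm (p v))\<^sup>2 \<le> (1 / m) * second_moment_form P v" for v
  proof (cases "p v = 0")
    case True then show ?thesis using m second_moment_form_nonneg by simp
  next
    case False
    have "(1 / norm (p v)) *\<^sub>R p v \<in> S"
      using False p(2) by (auto simp: S_def)
    from m(2)[OF this] have "m * (norm (p v))\<^sup>2 \<le> second_moment_form P (p v)"
      using False unfolding second_moment_form_scale by (simp add: field_simps)
    also have "second_moment_form P (p v) = second_moment_form P v"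
      unfolding second_moment_form_def using AEp by (intro integral_cong_AE) auto
    finally show ?thesis using m by (simp add: field_simps)
  qed
  with m AEp show thesis by (intro that[of "1 / m" p]) auto
qed

end

context bounded_law begin

lemma integrable_continuous:
  fixes f :: "'a \<Rightarrow> 'c::{banach, second_countable_topology}"
  assumes "continuous_on UNIV f"
  shows "integrable P f"
proof -
  have "bounded (f ` cball 0 b)"
    using continuous_on_subset[OF assms]
    by (intro compact_imp_bounded compact_continuous_image) auto
  then have "\<exists>B. \<forall>x. norm x \<le> b \<longrightarrow> norm (f x) \<le> B"
    by (metis bounded_iff image_eqI mem_cball_0)
  then obtain B where B: "\<And>x. norm x \<le> b \<Longrightarrow> norm (f x) \<le> B" by blast
  show ?thesis
  proof (rule integrable_const_bound)
    show "AE x in P. norm (f x) \<le> B" using bounded by eventually_elim (rule B)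
    show "f \<in> borel_measurable P"
      using borel_measurable_continuous_onI[OF assms] by (simp add: measurable_cong_sets[OF sets_P refl])
  qed
qed

text \<open>The tangent of the quadratic form at the mean lies below the form; integrating
  this linear bound replaces a general Jensen inequality in several variables.\<close>

lemma second_moment_form_Jensen:
  assumes "bounded_law \<rho> r"
  shows "second_moment_form P ((\<integral>u. u \<partial>\<rho>) - u0) \<le> (\<integral>u. second_moment_form P (u - u0) \<partial>\<rho>)"
proof -
  interpret \<rho>: bounded_law \<rho> r by fact
  define w where "w = (\<integral>u. u \<partial>\<rho>) - u0"
  define g where "g = (\<integral>x. (x \<bullet> w) *\<^sub>R x \<partial>P)"
  have int_g: "integrable P (\<lambda>x. (x \<bullet> w) *\<^sub>R x)"
    by (intro integrable_continuous continuous_intros)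
  have g: "(\<integral>x. (x \<bullet> v) * (x \<bullet> w) \<partial>P) = g \<bullet> v" for v
    unfolding g_def by (subst integral_inner_left[symmetric]) (auto simp: int_g mult.commute)
  have gw: "g \<bullet> w = second_moment_form P w"
    using g[of w] by (simp add: second_moment_form_def power2_eq_square)
  have tangent: "2 * (g \<bullet> v) - second_moment_form P w \<le> second_moment_form P v" for v
  proof -
    have "0 \<le> (\<integral>x. (x \<bullet> v - x \<bullet> w)\<^sup>2 \<partial>P)" by simp
    also have "\<dots> = (\<integral>x. (x \<bullet> v)\<^sup>2 + (x \<bullet> w)\<^sup>2 - 2 * ((x \<bullet> v) * (x \<bullet> w)) \<partial>P)"
      by (simp add: power2_diff mult.assoc)
    also have "\<dots> = second_moment_form P v + second_moment_form P w - 2 * (g \<bullet> v)"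
      by (simp add: integrable_inner_mult integrable_inner_square second_moment_form_def g)
    finally show ?thesis by simp
  qed
  have int_id: "integrable \<rho> (\<lambda>u. u)"
    by (intro \<rho>.integrable_continuous continuous_intros)
  have "2 * (g \<bullet> w) - second_moment_form P w
      = (\<integral>u. 2 * (g \<bullet> (u - u0)) - second_moment_form P w \<partial>\<rho>)"
    using int_id by (simp add: w_def \<rho>.prob_space inner_diff_right)
  also have "\<dots> \<le> (\<integral>u. second_moment_form P (u - u0) \<partial>\<rho>)"
    by (intro integral_mono \<rho>.integrable_continuous continuous_intros tangent
        continuous_on_compose2[OF continuous_second_moment_form[of UNIV]]) auto
  finally show ?thesis by (simp add: gw flip: w_def)
qed

end

section \<open>Laws reweighted by a positive continuous function\<close>

definition tilted :: "'a measure \<Rightarrow> ('a \<Rightarrow> real) \<Rightarrow> 'a measure" where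
  "tilted P h = density P (\<lambda>u. ennreal (h u / (\<integral>v. h v \<partial>P)))"

lemma tilted_cmult: "c \<noteq> 0 \<Longrightarrow> tilted P (\<lambda>u. c * h u) = tilted P h"
  by (simp add: tilted_def)

locale tilted_law = bounded_law P b for P :: "'a::euclidean_space measure" and b +
  fixes h :: "'a \<Rightarrow> real"
  assumes continuous_h: "continuous_on UNIV h" and h_pos: "\<And>u. h u > 0"
begin

abbreviation "Z \<equiv> (\<integral>u. h u \<partial>P)"

lemma integrable_h: "integrable P h"
  by (rule integrable_continuous[OF continuous_h])

lemma measurable_h [measurable]: "h \<in> borel_measurable P"
  using integrable_h by auto

lemma Z_pos: "Z > 0"
proof -
  have "Z \<noteq> 0"
  proof
    assume "Z = 0"
    then have "AE u in P. h u = 0"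
      by (subst (asm) integral_nonneg_eq_0_iff_AE) (auto simp: integrable_h less_imp_le[OF h_pos])
    then have "AE u in P. False"
      by eventually_elim (metis h_pos less_irrefl)
    then show False by simp
  qed
  moreover have "Z \<ge> 0" by (simp add: less_imp_le[OF h_pos])
  ultimately show ?thesis by simp
qed

lemma integral_tilted:
  fixes g :: "'a \<Rightarrow> 'c::{banach, second_countable_topology}"
  assumes [measurable]: "g \<in> borel_measurable borel"
  shows "(\<integral>u. g u \<partial>tilted P h) = (1 / Z) *\<^sub>R (\<integral>u. h u *\<^sub>R g u \<partial>P)"
proof -
  have "(\<integral>u. g u \<partial>tilted P h) = (\<integral>u. (h u / Z) *\<^sub>R g u \<partial>P)"
    unfolding tilted_def using h_pos Z_pos
    by (intro integral_density) (auto simp: less_imp_le)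
  also have "\<dots> = (\<integral>u. (1 / Z) *\<^sub>R (h u *\<^sub>R g u) \<partial>P)" by simp
  finally show ?thesis by (simp only: integral_scaleR_right)
qed

lemma bounded_law_tilted: "bounded_law (tilted P h) b"
proof -
  have "emeasure (tilted P h) (space (tilted P h)) = (\<integral>\<^sup>+ u. ennreal (h u / Z) \<partial>P)"
    unfolding tilted_def by (subst emeasure_density) (auto cong: nn_integral_cong)
  also have "\<dots> = ennreal (\<integral>u. h u / Z \<partial>P)"
    using h_pos Z_pos by (intro nn_integral_eq_integral) (auto simp: integrable_h less_imp_le)
  also have "\<dots> = 1" using Z_pos by simp
  finally have "prob_space (tilted P h)" by (rule prob_spaceI)
  moreover have "AE u in tilted P h. norm u \<le> b"
    unfolding tilted_def using bounded by (subst AE_density) auto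
  ultimately show ?thesis
    unfolding bounded_law_def bounded_law_axioms_def by (simp add: tilted_def sets_P)
qed

text \<open>With \<open>t = (K - ln Z) / a\<close> the hypothesis reads \<open>h u \<le> Z exp (- a (q u - t))\<close>. So
  \<open>(q u - t) h u\<close> is at most \<open>Z\<close> times the maximum \<open>1 / a\<close> of \<open>s exp (- a s)\<close> (using \<open>s exp (- s) \<le> 1\<close>),
  and integrating gives \<open>t + 1 / a\<close>.\<close>

lemma tilted_expectation_le:
  assumes a: "a > 0" and cont: "continuous_on UNIV q"
    and le: "\<And>u. h u \<le> exp (K - a * q u)"
  shows "(\<integral>u. q u \<partial>tilted P h) \<le> (K - ln Z + 1) / a"
proof -
  define t where "t = (K - ln Z) / a"
  have *: "h u * q u \<le> t * h u + Z / a" for u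
  proof (cases "q u \<le> t")
    case True
    then have "h u * q u \<le> t * h u" using h_pos[of u] by (simp add: mult.commute)
    also have "\<dots> \<le> t * h u + Z / a" using a Z_pos by simp
    finally show ?thesis .
  next
    case False
    define s where "s = a * (q u - t)"
    have s: "q u - t = s / a" "K - a * q u = - s + ln Z"
      using a by (simp_all add: s_def t_def field_simps)
    have "s \<le> exp s" using exp_ge_add_one_self[of s] by linarith
    then have "s * exp (- s) \<le> 1" by (simp add: exp_minus divide_simps)
    have "h u * (q u - t) \<le> exp (K - a * q u) * (q u - t)"
      using le[of u] False by (intro mult_right_mono) auto
    also have "\<dots> = s * exp (- s) * exp (ln Z) / a"
      by (simp only: s exp_add) simp
    also have "\<dots> \<le> 1 * exp (ln Z) / a"
      using a \<open>s * exp (- s) \<le> 1\<close> by (intro mult_right_mono divide_right_mono) auto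
    finally show ?thesis using Z_pos by (simp add: algebra_simps)
  qed
  have int: "integrable P (\<lambda>u. h u * q u)"
    by (intro integrable_continuous continuous_intros continuous_h cont)
  have "(\<integral>u. q u \<partial>tilted P h) = (\<integral>u. h u * q u \<partial>P) / Z"
    using integral_tilted[of q] borel_measurable_continuous_onI[OF cont] by simp
  also have "\<dots> \<le> (\<integral>u. t * h u + Z / a \<partial>P) / Z"
    using Z_pos int integrable_h * by (intro divide_right_mono integral_mono) auto
  also have "\<dots> = t + 1 / a"
    using Z_pos integrable_h by (simp add: prob_space add_divide_distrib)
  also have "\<dots> = (K - ln Z + 1) / a"
    by (simp add: t_def add_divide_distrib)
  finally show ?thesis .
qed

lemma normaliser_ge:
  assumes "\<And>u. u \<in> ball u0 r \<Longrightarrow> exp (- l) \<le> h u"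
  shows "measure P (ball u0 r) * exp (- l) \<le> Z"
proof -
  have "measure P (ball u0 r) * exp (- l) = (\<integral>u. indicator (ball u0 r) u * exp (- l) \<partial>P)"
    by (simp add: sets_P sets_eq_imp_space_eq[OF sets_P])
  also have "\<dots> \<le> Z"
    using assms h_pos
    by (intro integral_mono integrable_h integrable_mult_left integrable_real_indicator)
       (auto simp: indicator_def less_imp_le sets_P emeasure_finite less_top[symmetric])
  finally show ?thesis .
qed

end

section \<open>The Gaussian likelihood ratio\<close>

text \<open>The Gaussian likelihood at \<open>u0 + v\<close> divided by that at \<open>u0\<close>, where \<open>e\<close> stands for the residuals at \<open>u0\<close>.\<close>

definition likelihood_ratio ::
  "(nat \<Rightarrow> 'a::real_inner) \<Rightarrow> (nat \<Rightarrow> real) \<Rightarrow> nat \<Rightarrow> 'a \<Rightarrow> real" where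
  "likelihood_ratio x e n v = exp ((\<Sum>i=1..n. e i * (x i \<bullet> v)) - (\<Sum>i=1..n. (x i \<bullet> v)\<^sup>2) / 2)"

lemma likelihood_ratio_pos: "likelihood_ratio x e n v > 0"
  by (simp add: likelihood_ratio_def)

lemma gauss_likelihood_factor:
  "gauss_likelihood x y n u =
     exp (- (\<Sum>i=1..n. (y i - x i \<bullet> u0)\<^sup>2) / 2) * likelihood_ratio x (\<lambda>i. y i - x i \<bullet> u0) n (u - u0)"
proof -
  have "- (sq_loss (y i) (x i) u / 2) =
      - (y i - x i \<bullet> u0)\<^sup>2 / 2 + ((y i - x i \<bullet> u0) * (x i \<bullet> (u - u0)) - (x i \<bullet> (u - u0))\<^sup>2 / 2)" for i
    by (simp add: sq_loss_def inner_diff_right power2_eq_square field_simps)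
  then show ?thesis
    by (simp add: gauss_likelihood_def likelihood_ratio_def sum.distrib sum_subtractf
        sum_negf sum_divide_distrib flip: exp_add)
qed

text \<open>The factor of the likelihood that does not involve \<open>u\<close> cancels in the posterior, which leaves
  weights centred at the true parameter.\<close>

lemma posterior_eq_tilted:
  "posterior prior x y n = tilted prior (\<lambda>u. likelihood_ratio x (\<lambda>i. y i - x i \<bullet> u0) n (u - u0))"
proof -
  have "posterior prior x y n = tilted prior (gauss_likelihood x y n)"
    by (simp add: posterior_def tilted_def)
  also have "gauss_likelihood x y n = (\<lambda>u. exp (- (\<Sum>i=1..n. (y i - x i \<bullet> u0)\<^sup>2) / 2) *
      likelihood_ratio x (\<lambda>i. y i - x i \<bullet> u0) n (u - u0))"
    by (rule ext) (rule gauss_likelihood_factor)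
  finally show ?thesis by (simp only: tilted_cmult[OF exp_not_eq_zero])
qed

lemma tilted_law_likelihood_ratio:
  assumes "bounded_law prior r"
  shows "tilted_law prior r (\<lambda>u. likelihood_ratio x e n (u - u0))"
  using assms unfolding tilted_law_def tilted_law_axioms_def likelihood_ratio_def
  by (auto intro!: continuous_intros)

text \<open>The inequality of arithmetic and geometric means, weighted so that the linear term of the log
  likelihood ratio uses up only half of the negative term \<open>- t / 4\<close> left by the quadratic one.\<close>

lemma abs_le_of_square_le_mult:
  fixes A t :: real
  assumes "s\<^sup>2 \<le> A * t" and t: "t \<ge> 0" and A: "A \<ge> 0"
  shows "\<bar>s\<bar> \<le> 2 * A + t / 8"
proof -
  have "A * t \<le> (2 * A + t / 8)\<^sup>2"
    using zero_le_power2[of "2 * A - t / 8"] by (simp add: power2_eq_square algebra_simps)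
  then have "s\<^sup>2 \<le> (2 * A + t / 8)\<^sup>2" using assms(1) by linarith
  then show ?thesis using A t by (simp add: abs_le_square_iff[symmetric])
qed

text \<open>The deterministic core. The hypotheses on design and noise give
  \<open>h u \<le> exp (2 A - n q u / 8)\<close> everywhere, and they also keep \<open>h\<close> above
  \<open>exp (- (2 A + n (b \<epsilon>)\<^sup>2))\<close> on the ball of radius \<open>\<epsilon>\<close>, which bounds the normalising constant from below.\<close>

lemma (in bounded_law) tilted_mean_bound:
  assumes prior: "bounded_law prior r" and n: "n \<ge> 1" and A: "A \<ge> 0" and m: "m > 0"
    and x: "\<And>i. i \<in> {1..n} \<Longrightarrow> norm (x i) \<le> b"
    and design: "\<And>v. real n / 2 * second_moment_form P v \<le> (\<Sum>i=1..n. (x i \<bullet> v)\<^sup>2)"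
    and noise: "\<And>v. (\<Sum>i=1..n. e i * (x i \<bullet> v))\<^sup>2 \<le> A * (real n * second_moment_form P v)"
    and small_ball: "m \<le> measure prior (ball u0 \<epsilon>)" and \<epsilon>: "\<epsilon> > 0"
  shows "second_moment_form P ((\<integral>u. u \<partial>tilted prior (\<lambda>u. likelihood_ratio x e n (u - u0))) - u0)
    \<le> 8 / real n * (4 * A + 1 - ln m + real n * (b * \<epsilon>)\<^sup>2)"
proof -
  define h where "h u = likelihood_ratio x e n (u - u0)" for u
  define q where "q u = second_moment_form P (u - u0)" for u
  interpret T: tilted_law prior r h
    using tilted_law_likelihood_ratio[OF prior] by (simp add: h_def[abs_def])
  have b: "b \<ge> 0" using order_trans[OF norm_ge_zero x[of 1]] n by simp
  have q0: "q u \<ge> 0" for u by (simp add: q_def second_moment_form_nonneg)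
  have cont_q: "continuous_on UNIV q" unfolding q_def
    by (intro continuous_on_compose2[OF continuous_second_moment_form[of UNIV]] continuous_intros) auto
  have le: "h u \<le> exp (2 * A - real n / 8 * q u)" for u
    using abs_le_of_square_le_mult[OF noise[of "u - u0"]] design[of "u - u0"] q0[of u] A
    by (simp add: h_def likelihood_ratio_def q_def)
  have ge: "exp (- (2 * A + real n * (b * \<epsilon>)\<^sup>2)) \<le> h u" if u: "u \<in> ball u0 \<epsilon>" for u
  proof -
    define v where "v = u - u0"
    have v: "norm v \<le> \<epsilon>" using u by (simp add: v_def dist_norm norm_minus_commute)
    have sq: "(b * norm v)\<^sup>2 \<le> (b * \<epsilon>)\<^sup>2" using v b \<epsilon> by (intro power_mono mult_left_mono) auto
    have "(x i \<bullet> v)\<^sup>2 \<le> (b * \<epsilon>)\<^sup>2" if "i \<in> {1..n}" for i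
    proof -
      have "\<bar>x i \<bullet> v\<bar> \<le> b * norm v"
        using Cauchy_Schwarz_ineq2[of "x i" v] mult_right_mono[OF x[OF that], of "norm v"] by simp
      then have "(x i \<bullet> v)\<^sup>2 \<le> (b * norm v)\<^sup>2"
        by (metis abs_ge_zero power2_abs power_mono)
      then show ?thesis using sq by linarith
    qed
    then have 1: "(\<Sum>i=1..n. (x i \<bullet> v)\<^sup>2) \<le> real n * (b * \<epsilon>)\<^sup>2"
      using sum_bounded_above[of "{1..n}" "\<lambda>i. (x i \<bullet> v)\<^sup>2"] by simp
    have "second_moment_form P v \<le> (b * \<epsilon>)\<^sup>2"
      using second_moment_form_le[of v] sq by (simp add: power_mult_distrib)
    then have 2: "real n * second_moment_form P v \<le> real n * (b * \<epsilon>)\<^sup>2"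
      by (rule mult_left_mono) simp
    have "\<bar>\<Sum>i=1..n. e i * (x i \<bullet> v)\<bar> \<le> 2 * A + real n * second_moment_form P v / 8"
      using abs_le_of_square_le_mult[OF noise[of v]] A second_moment_form_nonneg by simp
    moreover have "real n * (b * \<epsilon>)\<^sup>2 \<ge> 0" by simp
    ultimately have "- (2 * A + real n * (b * \<epsilon>)\<^sup>2)
        \<le> (\<Sum>i=1..n. e i * (x i \<bullet> v)) - (\<Sum>i=1..n. (x i \<bullet> v)\<^sup>2) / 2"
      using 1 2 by linarith
    then show ?thesis by (simp add: h_def likelihood_ratio_def v_def)
  qed
  have "m * exp (- (2 * A + real n * (b * \<epsilon>)\<^sup>2)) \<le> T.Z"
    using T.normaliser_ge[OF ge] small_ball by (meson exp_ge_zero mult_right_mono order_trans)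
  then have "ln (m * exp (- (2 * A + real n * (b * \<epsilon>)\<^sup>2))) \<le> ln T.Z"
    using m by (intro ln_mono) auto
  then have lnZ: "ln m - (2 * A + real n * (b * \<epsilon>)\<^sup>2) \<le> ln T.Z"
    using m by (simp add: ln_mult)
  have "second_moment_form P ((\<integral>u. u \<partial>tilted prior h) - u0) \<le> (\<integral>u. q u \<partial>tilted prior h)"
    unfolding q_def by (rule second_moment_form_Jensen[OF T.bounded_law_tilted])
  also have "\<dots> \<le> (2 * A - ln T.Z + 1) / (real n / 8)"
    using n by (intro T.tilted_expectation_le[OF _ cont_q le]) auto
  also have "\<dots> = 8 / real n * (2 * A - ln T.Z + 1)" by simp
  also have "\<dots> \<le> 8 / real n * (4 * A + 1 - ln m + real n * (b * \<epsilon>)\<^sup>2)"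
    using lnZ by (intro mult_left_mono) auto
  finally show ?thesis by (simp add: h_def[abs_def])
qed

text \<open>The radius \<open>n powr (- \<beta> / 2)\<close> makes the likelihood cost \<open>n \<epsilon>\<^sup>2\<close> equal to \<open>n powr (1 - \<beta>)\<close>; the cost
  \<open>\<epsilon> powr (- \<kappa>) = n powr (\<beta> \<kappa> / 2)\<close> of the small prior mass does not exceed this, because
  \<open>\<beta> (1 + \<kappa>) < 1\<close>.\<close>

lemma rate_arithmetic:
  assumes n: "n \<ge> (1::real)" and \<beta>: "\<beta> > 0" "\<beta> < 1 / (1 + \<kappa>)" and \<kappa>: "\<kappa> > 0"
    and C: "C1 > 0" "C2 > 0" and A: "A \<ge> 0"
  shows "8 / n * (4 * A + 1 - ln (C1 * exp (- C2 * (n powr (- \<beta> / 2)) powr (- \<kappa>)))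
      + n * (b * n powr (- \<beta> / 2))\<^sup>2) \<le> 8 * (4 * A + 1 + \<bar>ln C1\<bar> + C2 + b\<^sup>2) * n powr (- \<beta>)"
proof -
  have \<beta>\<kappa>: "\<beta> * (1 + \<kappa>) < 1" using \<beta> \<kappa> by (simp add: field_simps)
  have "\<beta> * \<kappa> / 2 \<le> 1 - \<beta>"
    using \<beta>\<kappa> mult_pos_pos[OF \<beta>(1) \<kappa>] by (simp add: algebra_simps)
  then have 1: "n powr (\<beta> * \<kappa> / 2) \<le> n powr (1 - \<beta>)" using n by (intro powr_mono) auto
  have "\<beta> \<le> 1" using \<beta>\<kappa> mult_pos_pos[OF \<beta>(1) \<kappa>] by (simp add: algebra_simps)
  then have 2: "1 \<le> n powr (1 - \<beta>)" using n by (simp add: ge_one_powr_ge_zero)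
  have 4: "n powr (1 - \<beta>) = n * n powr (- \<beta>)"
    using n powr_add[of n 1 "- \<beta>"] by simp
  have 3: "n * (n powr (- \<beta> / 2))\<^sup>2 = n powr (1 - \<beta>)"
    unfolding 4 power2_eq_square by (simp flip: powr_add)
  have "ln (C1 * exp (- C2 * (n powr (- \<beta> / 2)) powr (- \<kappa>))) = ln C1 - C2 * n powr (\<beta> * \<kappa> / 2)"
    using C by (simp add: ln_mult powr_powr)
  then have "4 * A + 1 - ln (C1 * exp (- C2 * (n powr (- \<beta> / 2)) powr (- \<kappa>)))
      + n * (b * n powr (- \<beta> / 2))\<^sup>2
      = (4 * A + 1 - ln C1) + C2 * n powr (\<beta> * \<kappa> / 2) + b\<^sup>2 * n powr (1 - \<beta>)"
    using 3 by (simp add: power_mult_distrib mult_ac)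
  also have "\<dots> \<le> (4 * A + 1 + \<bar>ln C1\<bar>) * n powr (1 - \<beta>) + C2 * n powr (1 - \<beta>) + b\<^sup>2 * n powr (1 - \<beta>)"
  proof (intro add_mono order_refl)
    have "4 * A + 1 - ln C1 \<le> (4 * A + 1 + \<bar>ln C1\<bar>) * 1" by simp
    also have "\<dots> \<le> (4 * A + 1 + \<bar>ln C1\<bar>) * n powr (1 - \<beta>)"
      using 2 A by (intro mult_left_mono) auto
    finally show "4 * A + 1 - ln C1 \<le> (4 * A + 1 + \<bar>ln C1\<bar>) * n powr (1 - \<beta>)" .
  qed (use 1 C in auto)
  also have "\<dots> = (4 * A + 1 + \<bar>ln C1\<bar> + C2 + b\<^sup>2) * (n * n powr (- \<beta>))"
    by (simp add: 4 algebra_simps)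
  finally show ?thesis using n by (simp add: field_simps)
qed

section \<open>The design and noise fluctuations\<close>

text \<open>The squared Frobenius norm of the centred Gram matrix of the sample plus the squared norm of
  the noise vector, written out in coordinates so that each entry is a sum of independent variables.\<close>

definition fluctuation ::
  "'a::euclidean_space measure \<Rightarrow> (nat \<Rightarrow> 'a) \<Rightarrow> (nat \<Rightarrow> real) \<Rightarrow> nat \<Rightarrow> real" where
  "fluctuation P x e n =
     (\<Sum>a\<in>Basis. \<Sum>c\<in>Basis.
        (\<Sum>i=1..n. (x i \<bullet> a) * (x i \<bullet> c) - (\<integral>z. (z \<bullet> a) * (z \<bullet> c) \<partial>P))\<^sup>2)
     + (\<Sum>a\<in>Basis. (\<Sum>i=1..n. e i * (x i \<bullet> a))\<^sup>2)"

text \<open>Both bounds are uniform in \<open>v\<close> and relative to the possibly degenerate form: since the sample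
  lies in the complement of the kernel, \<open>v\<close> can be replaced by \<open>p v\<close>, whose squared norm the form
  controls. The entries of the centred design matrix are of order \<open>sqrt n\<close>, hence eventually
  negligible against the \<open>n / 2\<close> given away in the first bound.\<close>

lemma (in bounded_law) design_and_noise_bounds:
  assumes c: "c > 0" and p: "\<And>v. (norm (p v))\<^sup>2 \<le> c * second_moment_form P v"
    and AEp: "AE z in P. \<forall>v. z \<bullet> p v = z \<bullet> v"
    and xp: "\<And>i v. i \<in> {1..n} \<Longrightarrow> x i \<bullet> p v = x i \<bullet> v"
    and fl: "fluctuation P x e n \<le> real n * C" and C: "C \<ge> 0"
    and n: "2 * (real DIM('a))\<^sup>2 * c * sqrt C \<le> sqrt (real n)"
  shows "real n / 2 * second_moment_form P v \<le> (\<Sum>i=1..n. (x i \<bullet> v)\<^sup>2)" (is ?design)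
    and "(\<Sum>i=1..n. e i * (x i \<bullet> v))\<^sup>2 \<le> C * c * (real n * second_moment_form P v)" (is ?noise)
proof -
  define D where "D a d = (\<Sum>i=1..n. (x i \<bullet> a) * (x i \<bullet> d) - (\<integral>z. (z \<bullet> a) * (z \<bullet> d) \<partial>P))" for a d
  define w where "w = p v"
  have D_sq: "(D a d)\<^sup>2 \<le> real n * C" if "a \<in> Basis" "d \<in> Basis" for a d
  proof -
    have "(D a d)\<^sup>2 \<le> (\<Sum>d\<in>Basis. (D a d)\<^sup>2)"
      using that by (intro member_le_sum) auto
    also have "\<dots> \<le> (\<Sum>a\<in>Basis. \<Sum>d\<in>Basis. (D a d)\<^sup>2)"
      using that by (intro member_le_sum[of a Basis "\<lambda>a. \<Sum>d\<in>Basis. (D a d)\<^sup>2"]) (auto intro: sum_nonneg)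
    also have "\<dots> \<le> fluctuation P x e n"
      unfolding fluctuation_def D_def by (simp add: sum_nonneg)
    finally show ?thesis using fl by simp
  qed
  have D_abs: "\<bar>D a d\<bar> \<le> sqrt (real n) * sqrt C" if "a \<in> Basis" "d \<in> Basis" for a d
    using real_sqrt_le_mono[OF D_sq[OF that]] by (simp add: real_sqrt_mult)
  have qw: "second_moment_form P w = second_moment_form P v"
    unfolding second_moment_form_def w_def using AEp by (intro integral_cong_AE) auto
  have "(\<Sum>i=1..n. (x i \<bullet> v)\<^sup>2) = (\<Sum>i=1..n. (x i \<bullet> w)\<^sup>2)"
    by (intro sum.cong) (auto simp: w_def xp)
  also have "\<dots> = (\<Sum>a\<in>Basis. \<Sum>d\<in>Basis. (\<Sum>i=1..n. (x i \<bullet> a) * (x i \<bullet> d)) * ((w \<bullet> a) * (w \<bullet> d)))"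
    unfolding inner_square_expand[of _ w] sum_distrib_right
    by (subst sum.swap, intro sum.cong refl, subst sum.swap) simp
  finally have diff: "(\<Sum>i=1..n. (x i \<bullet> v)\<^sup>2) - real n * second_moment_form P v
      = (\<Sum>a\<in>Basis. \<Sum>d\<in>Basis. D a d * ((w \<bullet> a) * (w \<bullet> d)))"
    unfolding qw[symmetric] second_moment_form_expand[of w] D_def sum_distrib_left
    by (simp add: sum_subtractf algebra_simps)
  have "\<bar>\<Sum>a\<in>Basis. \<Sum>d\<in>Basis. D a d * ((w \<bullet> a) * (w \<bullet> d))\<bar>
      \<le> (\<Sum>a\<in>(Basis::'a set). \<Sum>d\<in>(Basis::'a set). (sqrt (real n) * sqrt C) * (norm w * norm w))"
  proof (intro sum_abs[THEN order_trans] sum_mono)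
    fix a d :: 'a assume "a \<in> Basis" "d \<in> Basis"
    then have "\<bar>D a d\<bar> * (\<bar>w \<bullet> a\<bar> * \<bar>w \<bullet> d\<bar>) \<le> (sqrt (real n) * sqrt C) * (norm w * norm w)"
      using C by (intro mult_mono D_abs Basis_le_norm) auto
    then show "\<bar>D a d * ((w \<bullet> a) * (w \<bullet> d))\<bar> \<le> (sqrt (real n) * sqrt C) * (norm w * norm w)"
      by (simp add: abs_mult)
  qed
  also have "\<dots> = ((real DIM('a))\<^sup>2 * sqrt C * sqrt (real n)) * (norm w)\<^sup>2"
    by (simp add: power2_eq_square)
  also have "\<dots> \<le> ((real DIM('a))\<^sup>2 * sqrt C * sqrt (real n)) * (c * second_moment_form P v)"
    using p[of v] C by (intro mult_left_mono) (auto simp: w_def)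
  also have "\<dots> = (2 * (real DIM('a))\<^sup>2 * c * sqrt C) * (sqrt (real n) * second_moment_form P v / 2)"
    by simp
  also have "\<dots> \<le> sqrt (real n) * (sqrt (real n) * second_moment_form P v / 2)"
    using n second_moment_form_nonneg[of v] by (intro mult_right_mono) auto
  also have "\<dots> = real n / 2 * second_moment_form P v"
    using real_sqrt_mult_self[of "real n"] by (simp only: mult.assoc[symmetric] times_divide_eq_right)
  finally have "\<bar>(\<Sum>i=1..n. (x i \<bullet> v)\<^sup>2) - real n * second_moment_form P v\<bar>
      \<le> real n / 2 * second_moment_form P v"
    by (simp only: diff)
  then show ?design by (simp only: abs_le_iff) linarith
  define S where "S = (\<Sum>i=1..n. e i *\<^sub>R x i)"
  have "(norm S)\<^sup>2 = (\<Sum>a\<in>Basis. (S \<bullet> a)\<^sup>2)"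
    by (subst power2_norm_eq_inner, subst euclidean_inner) (simp add: power2_eq_square)
  also have "\<dots> = (\<Sum>a\<in>Basis. (\<Sum>i=1..n. e i * (x i \<bullet> a))\<^sup>2)"
    by (simp add: S_def inner_sum_left)
  also have "\<dots> \<le> real n * C"
  proof (rule order_trans[OF _ fl])
    show "(\<Sum>a\<in>Basis. (\<Sum>i=1..n. e i * (x i \<bullet> a))\<^sup>2) \<le> fluctuation P x e n"
      unfolding fluctuation_def by (simp add: sum_nonneg)
  qed
  finally have S: "(norm S)\<^sup>2 \<le> real n * C" .
  have "(\<Sum>i=1..n. e i * (x i \<bullet> v)) = S \<bullet> w"
    unfolding S_def inner_sum_left by (intro sum.cong) (auto simp: w_def xp)
  then have "(\<Sum>i=1..n. e i * (x i \<bullet> v))\<^sup>2 \<le> (norm S)\<^sup>2 * (norm w)\<^sup>2"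
    using Cauchy_Schwarz_ineq[of S w] by (simp add: power2_norm_eq_inner)
  also have "\<dots> \<le> (real n * C) * (c * second_moment_form P v)"
    using S p[of v] C by (intro mult_mono) (auto simp: w_def)
  finally show ?noise by (simp add: mult_ac)
qed

text \<open>Every entry in the fluctuation is a sum of \<open>n\<close> independent centred terms with bounded second
  moments, so one constant works for all \<open>n\<close>.\<close>

lemma (in prob_space) expected_fluctuation:
  fixes Xs :: "nat \<Rightarrow> 'a \<Rightarrow> 'b::euclidean_space" and e :: "nat \<Rightarrow> 'a \<Rightarrow> real"
  assumes "bounded_law P b"
    and ind: "indep_vars (\<lambda>_. borel \<Otimes>\<^sub>M borel) (\<lambda>i \<omega>. (Xs i \<omega>, e i \<omega>)) {1..}"
    and law: "\<And>i. i \<ge> 1 \<Longrightarrow> distr M borel (Xs i) = P"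
    and e2: "\<And>i. i \<ge> 1 \<Longrightarrow> integrable M (\<lambda>\<omega>. (e i \<omega>)\<^sup>2)"
    and s: "\<And>i. i \<ge> 1 \<Longrightarrow> expectation (\<lambda>\<omega>. (e i \<omega>)\<^sup>2) \<le> s"
    and uncorrelated: "\<And>i a. i \<ge> 1 \<Longrightarrow> expectation (\<lambda>\<omega>. e i \<omega> * (Xs i \<omega> \<bullet> a)) = 0"
  obtains C where "C \<ge> 0"
    "\<And>n. integrable M (\<lambda>\<omega>. fluctuation P (\<lambda>i. Xs i \<omega>) (\<lambda>i. e i \<omega>) n)"
    "\<And>n. expectation (\<lambda>\<omega>. fluctuation P (\<lambda>i. Xs i \<omega>) (\<lambda>i. e i \<omega>) n) \<le> real n * C"
proof -
  interpret P: bounded_law P b by fact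
  have pair: "(\<lambda>\<omega>. (Xs i \<omega>, e i \<omega>)) \<in> measurable M (borel \<Otimes>\<^sub>M borel)" if "i \<ge> 1" for i
    using ind that unfolding indep_vars_def by auto
  have Xm: "Xs i \<in> borel_measurable M" and em: "e i \<in> borel_measurable M" if "i \<ge> 1" for i
    using measurable_compose[OF pair[OF that] measurable_fst]
      measurable_compose[OF pair[OF that] measurable_snd] by simp_all
  have AEb: "AE \<omega> in M. norm (Xs i \<omega>) \<le> b" if "i \<ge> 1" for i
    using P.bounded unfolding law[OF that, symmetric] by (rule AE_distrD[OF Xm[OF that]])
  define V where "V a c = (\<integral>z. ((z \<bullet> a) * (z \<bullet> c) - (\<integral>z. (z \<bullet> a) * (z \<bullet> c) \<partial>P))\<^sup>2 \<partial>P)" for a c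
  have design: "integrable M (\<lambda>\<omega>. (\<Sum>i=1..n. (Xs i \<omega> \<bullet> a) * (Xs i \<omega> \<bullet> c) - (\<integral>z. (z \<bullet> a) * (z \<bullet> c) \<partial>P))\<^sup>2)
      \<and> expectation (\<lambda>\<omega>. (\<Sum>i=1..n. (Xs i \<omega> \<bullet> a) * (Xs i \<omega> \<bullet> c) - (\<integral>z. (z \<bullet> a) * (z \<bullet> c) \<partial>P))\<^sup>2)
        = real n * V a c" for n a c
  proof -
    define G where "G = (\<integral>z. (z \<bullet> a) * (z \<bullet> c) \<partial>P)"
    have iv: "indep_vars (\<lambda>_. borel) (\<lambda>i \<omega>. (Xs i \<omega> \<bullet> a) * (Xs i \<omega> \<bullet> c) - G) {1..n}"
      using indep_vars_compose2[OF indep_vars_subset[OF ind, of "{1..n}"],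
          of "\<lambda>i (x, y). (x \<bullet> a) * (x \<bullet> c) - G" "\<lambda>_. borel"] by (auto simp: split_beta)
    have transfer: "integrable M (\<lambda>\<omega>. f (Xs i \<omega>))" "expectation (\<lambda>\<omega>. f (Xs i \<omega>)) = (\<integral>z. f z \<partial>P)"
      if "i \<ge> 1" and "continuous_on UNIV f" for i and f :: "'b \<Rightarrow> real"
      using P.integrable_continuous[OF that(2)] borel_measurable_continuous_onI[OF that(2)]
      unfolding law[OF that(1), symmetric]
      by (simp_all add: integrable_distr_eq integral_distr Xm[OF that(1)])
    have 1: "integrable M (\<lambda>\<omega>. ((Xs i \<omega> \<bullet> a) * (Xs i \<omega> \<bullet> c) - G)\<^sup>2)"
      and 2: "expectation (\<lambda>\<omega>. ((Xs i \<omega> \<bullet> a) * (Xs i \<omega> \<bullet> c) - G)\<^sup>2) = V a c" if "i \<in> {1..n}" for i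
    proof -
      have "continuous_on UNIV (\<lambda>z. ((z \<bullet> a) * (z \<bullet> c) - G)\<^sup>2)"
        by (intro continuous_intros)
      then show "integrable M (\<lambda>\<omega>. ((Xs i \<omega> \<bullet> a) * (Xs i \<omega> \<bullet> c) - G)\<^sup>2)"
        "expectation (\<lambda>\<omega>. ((Xs i \<omega> \<bullet> a) * (Xs i \<omega> \<bullet> c) - G)\<^sup>2) = V a c"
        using transfer[of i "\<lambda>z. ((z \<bullet> a) * (z \<bullet> c) - G)\<^sup>2"] that by (auto simp: V_def G_def)
    qed
    have centred: "(\<integral>z. (z \<bullet> a) * (z \<bullet> c) - G \<partial>P) = 0"
      using P.integrable_inner_mult[of a c] by (simp add: G_def P.prob_space)
    have 3: "expectation (\<lambda>\<omega>. (Xs i \<omega> \<bullet> a) * (Xs i \<omega> \<bullet> c) - G) = 0" if "i \<in> {1..n}" for i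
    proof -
      have "continuous_on UNIV (\<lambda>z. (z \<bullet> a) * (z \<bullet> c) - G)"
        by (intro continuous_intros)
      then show ?thesis
        using transfer(2)[of i "\<lambda>z. (z \<bullet> a) * (z \<bullet> c) - G"] that centred by simp
    qed
    show ?thesis
      using second_moment_indep_sum[OF iv _ 1 3] 2 by (simp add: G_def)
  qed
  have noise: "integrable M (\<lambda>\<omega>. (\<Sum>i=1..n. e i \<omega> * (Xs i \<omega> \<bullet> a))\<^sup>2)
      \<and> expectation (\<lambda>\<omega>. (\<Sum>i=1..n. e i \<omega> * (Xs i \<omega> \<bullet> a))\<^sup>2) \<le> real n * (b\<^sup>2 * s)"
    if a: "a \<in> Basis" for n a
  proof -
    have iv: "indep_vars (\<lambda>_. borel) (\<lambda>i \<omega>. e i \<omega> * (Xs i \<omega> \<bullet> a)) {1..n}"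
      using indep_vars_compose2[OF indep_vars_subset[OF ind, of "{1..n}"],
          of "\<lambda>i (x, y). y * (x \<bullet> a)" "\<lambda>_. borel"] by (auto simp: split_beta)
    have bnd: "AE \<omega> in M. (e i \<omega> * (Xs i \<omega> \<bullet> a))\<^sup>2 \<le> b\<^sup>2 * (e i \<omega>)\<^sup>2" if "i \<ge> 1" for i
      using AEb[OF that]
    proof eventually_elim
      case (elim \<omega>)
      have "\<bar>Xs i \<omega> \<bullet> a\<bar> \<le> b" using Basis_le_norm[OF a, of "Xs i \<omega>"] elim by linarith
      then have "(Xs i \<omega> \<bullet> a)\<^sup>2 \<le> b\<^sup>2" by (metis abs_ge_zero power2_abs power_mono)
      then show ?case
        using mult_right_mono[of "(Xs i \<omega> \<bullet> a)\<^sup>2" "b\<^sup>2" "(e i \<omega>)\<^sup>2"]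
        by (simp add: power_mult_distrib mult.commute)
    qed
    have 1: "integrable M (\<lambda>\<omega>. (e i \<omega> * (Xs i \<omega> \<bullet> a))\<^sup>2)" if "i \<ge> 1" for i
    proof (rule Bochner_Integration.integrable_bound[OF integrable_mult_right[OF e2[OF that]]])
      show "AE \<omega> in M. norm ((e i \<omega> * (Xs i \<omega> \<bullet> a))\<^sup>2) \<le> norm (b\<^sup>2 * (e i \<omega>)\<^sup>2)"
        using bnd[OF that] by eventually_elim simp
      show "(\<lambda>\<omega>. (e i \<omega> * (Xs i \<omega> \<bullet> a))\<^sup>2) \<in> borel_measurable M"
        using em[OF that] Xm[OF that] by measurable
    qed
    have 2: "expectation (\<lambda>\<omega>. (e i \<omega> * (Xs i \<omega> \<bullet> a))\<^sup>2) \<le> b\<^sup>2 * s" if "i \<ge> 1" for i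
    proof -
      have "expectation (\<lambda>\<omega>. (e i \<omega> * (Xs i \<omega> \<bullet> a))\<^sup>2) \<le> expectation (\<lambda>\<omega>. b\<^sup>2 * (e i \<omega>)\<^sup>2)"
        by (intro integral_mono_AE 1 bnd integrable_mult_right e2 that)
      also have "\<dots> \<le> b\<^sup>2 * s" using s[OF that] by (simp add: mult_left_mono)
      finally show ?thesis .
    qed
    have "expectation (\<lambda>\<omega>. (\<Sum>i=1..n. e i \<omega> * (Xs i \<omega> \<bullet> a))\<^sup>2)
        = (\<Sum>i=1..n. expectation (\<lambda>\<omega>. (e i \<omega> * (Xs i \<omega> \<bullet> a))\<^sup>2))"
      by (rule second_moment_indep_sum[OF iv]) (use 1 uncorrelated in auto)
    also have "\<dots> \<le> real n * (b\<^sup>2 * s)"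
      using sum_bounded_above[of "{1..n}" "\<lambda>i. expectation (\<lambda>\<omega>. (e i \<omega> * (Xs i \<omega> \<bullet> a))\<^sup>2)" "b\<^sup>2 * s"] 2
      by simp
    finally show ?thesis
      using second_moment_indep_sum(1)[OF iv] 1 uncorrelated by auto
  qed
  define C where "C = (\<Sum>a\<in>(Basis::'b set). \<Sum>c\<in>(Basis::'b set). V a c) + (\<Sum>a\<in>(Basis::'b set). b\<^sup>2 * s)"
  show thesis
  proof
    have "0 \<le> expectation (\<lambda>\<omega>. (e 1 \<omega>)\<^sup>2)" by simp
    also have "\<dots> \<le> s" by (rule s) simp
    finally show "C \<ge> 0" by (simp add: C_def V_def sum_nonneg)
    show "integrable M (\<lambda>\<omega>. fluctuation P (\<lambda>i. Xs i \<omega>) (\<lambda>i. e i \<omega>) n)" for n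
      unfolding fluctuation_def using design noise
      by (intro Bochner_Integration.integrable_add Bochner_Integration.integrable_sum) auto
    have "expectation (\<lambda>\<omega>. fluctuation P (\<lambda>i. Xs i \<omega>) (\<lambda>i. e i \<omega>) n)
        = (\<Sum>a\<in>(Basis::'b set). \<Sum>c\<in>(Basis::'b set). real n * V a c)
          + (\<Sum>a\<in>(Basis::'b set). expectation (\<lambda>\<omega>. (\<Sum>i=1..n. e i \<omega> * (Xs i \<omega> \<bullet> a))\<^sup>2))" for n
      unfolding fluctuation_def using design noise
      by (simp add: Bochner_Integration.integral_add Bochner_Integration.integrable_add
          Bochner_Integration.integrable_sum)
    also have "\<dots> n \<le> (\<Sum>a\<in>(Basis::'b set). \<Sum>c\<in>(Basis::'b set). real n * V a c)
          + (\<Sum>a\<in>(Basis::'b set). real n * (b\<^sup>2 * s))" for n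
      using noise by (intro add_left_mono sum_mono) auto
    also have "\<dots> n = real n * C" for n
      by (simp add: C_def sum_distrib_left distrib_left)
    finally show "expectation (\<lambda>\<omega>. fluctuation P (\<lambda>i. Xs i \<omega>) (\<lambda>i. e i \<omega>) n) \<le> real n * C" for n .
  qed
qed

text \<open>The posterior mean is a quotient of two integrals over the prior of functions that are jointly measurable in
  the sample and the parameter. Measurability is what makes the probability of the event in
  the theorem meaningful: a non-measurable set has measure \<open>0\<close> by convention.\<close>

lemma borel_measurable_posterior_mean:
  fixes Xs :: "nat \<Rightarrow> 'w \<Rightarrow> real ^ 'd" and Ys :: "nat \<Rightarrow> 'w \<Rightarrow> real"
  assumes "bounded_law prior r"
    and X: "\<And>i. i \<ge> 1 \<Longrightarrow> Xs i \<in> borel_measurable M"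
    and Y: "\<And>i. i \<ge> 1 \<Longrightarrow> Ys i \<in> borel_measurable M"
  shows "(\<lambda>\<omega>. posterior_mean prior (\<lambda>i. Xs i \<omega>) (\<lambda>i. Ys i \<omega>) n) \<in> borel_measurable M"
proof -
  interpret bounded_law prior r by fact
  define L where "L \<omega> u = gauss_likelihood (\<lambda>i. Xs i \<omega>) (\<lambda>i. Ys i \<omega>) n u" for \<omega> u
  have "(\<lambda>p. - (sq_loss (Ys i (fst p)) (Xs i (fst p)) (snd p) / 2)) \<in> borel_measurable (M \<Otimes>\<^sub>M prior)"
    if "i \<in> {1..n}" for i
  proof -
    have [measurable]: "Xs i \<in> borel_measurable M" "Ys i \<in> borel_measurable M"
      using that X Y by auto
    have [measurable]: "snd \<in> borel_measurable (M \<Otimes>\<^sub>M prior)"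
      using measurable_snd[of M prior] measurable_cong_sets[OF refl sets_P] by blast
    show ?thesis unfolding sq_loss_def by measurable
  qed
  then have L [measurable]: "(\<lambda>p. L (fst p) (snd p)) \<in> borel_measurable (M \<Otimes>\<^sub>M prior)"
    unfolding L_def gauss_likelihood_def by measurable
  have [measurable]: "snd \<in> borel_measurable (M \<Otimes>\<^sub>M prior)"
    using measurable_snd[of M prior] measurable_cong_sets[OF refl sets_P] by blast
  have Z: "(\<lambda>\<omega>. \<integral>u. L \<omega> u \<partial>prior) \<in> borel_measurable M"
    by (intro borel_measurable_lebesgue_integral) (use L in \<open>simp add: split_beta\<close>)
  have N: "(\<lambda>\<omega>. \<integral>u. L \<omega> u *\<^sub>R u \<partial>prior) \<in> borel_measurable M"
    by (intro borel_measurable_lebesgue_integral) (simp add: split_beta)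
  have "posterior_mean prior (\<lambda>i. Xs i \<omega>) (\<lambda>i. Ys i \<omega>) n
      = (1 / (\<integral>u. L \<omega> u \<partial>prior)) *\<^sub>R (\<integral>u. L \<omega> u *\<^sub>R u \<partial>prior)" for \<omega>
  proof -
    interpret tilted_law prior r "L \<omega>"
      by unfold_locales (auto simp: L_def gauss_likelihood_def sq_loss_def intro!: continuous_intros)
    show ?thesis
      using integral_tilted[of "\<lambda>u. u"]
      by (simp add: posterior_mean_def posterior_def tilted_def L_def)
  qed
  then show ?thesis using Z N by simp
qed

section \<open>The learning rate of the posterior mean\<close>

theorem theorem3:
  fixes M :: "'w measure"
    and X :: "'w \<Rightarrow> real ^ 'd" and Y :: "'w \<Rightarrow> real"
    and Xs :: "nat \<Rightarrow> 'w \<Rightarrow> real ^ 'd" and Ys eps :: "nat \<Rightarrow> 'w \<Rightarrow> real"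
    and XX U :: "(real ^ 'd) set" and u0 :: "real ^ 'd"
    and prior :: "(real ^ 'd) measure"
    and k M_u M_X \<kappa> \<beta> :: real
  assumes "prob_space M"
    and "X \<in> borel_measurable M" and "Y \<in> borel_measurable M"
    and "prob_space.indep_vars M (\<lambda>_. borel \<Otimes>\<^sub>M borel) (\<lambda>i \<omega>. (Xs i \<omega>, Ys i \<omega>)) {1..}"
    and "\<And>i. i \<ge> 1 \<Longrightarrow> distr M (borel \<Otimes>\<^sub>M borel) (\<lambda>\<omega>. (Xs i \<omega>, Ys i \<omega>))
                        = distr M (borel \<Otimes>\<^sub>M borel) (\<lambda>\<omega>. (X \<omega>, Y \<omega>))"
    and "\<And>i \<omega>. i \<ge> 1 \<Longrightarrow> \<omega> \<in> space M \<Longrightarrow> Ys i \<omega> = Xs i \<omega> \<bullet> u0 + eps i \<omega>"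
    and "\<And>i \<omega>. i \<ge> 1 \<Longrightarrow> \<omega> \<in> space M \<Longrightarrow> Xs i \<omega> \<in> XX"
    and "prob_space.indep_vars M (\<lambda>_. borel) eps {1..}"
    and "\<And>i. i \<ge> 1 \<Longrightarrow> distributed M lborel (eps i) (\<lambda>t. ennreal (student_t_density k t))"
    and "\<And>i. i \<ge> 1 \<Longrightarrow> indep_rvs M (Xs i) (eps i)"
    and "prob_space prior" and "sets prior = sets borel"
    and "bounded U" and "AE u in prior. u \<in> U" and "u0 \<in> U"
    and "norm u0 \<le> M_u" and "\<And>x. x \<in> XX \<Longrightarrow> norm x \<le> M_X"
    and "k > 4 * real CARD('d)"
    and "\<kappa> > 0" and "regular_prior (risk M X Y) U prior \<kappa>"
    and "\<beta> > 0" and "\<beta> < min (1 - 2 * sqrt (real CARD('d) / k)) (1 / (1 + \<kappa>))"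
  shows "\<forall>\<delta>\<in>{0<..<1}. \<exists>c>0. \<exists>N::nat>0. \<forall>n\<ge>N.
    measure M {\<omega> \<in> space M.
      risk M X Y (posterior_mean prior (\<lambda>i. Xs i \<omega>) (\<lambda>i. Ys i \<omega>) n)
        \<le> risk M X Y u0 + c * real n powr (- \<beta>)} \<ge> 1 - \<delta>"
proof (intro ballI)
  fix \<delta> :: real assume \<delta>: "\<delta> \<in> {0<..<1}"
  interpret prob_space M by fact
  have pair: "(\<lambda>\<omega>. (Xs i \<omega>, Ys i \<omega>)) \<in> measurable M (borel \<Otimes>\<^sub>M borel)" if "i \<ge> 1" for i
    using assms(4) that unfolding indep_vars_def by auto
  have Xm: "Xs i \<in> borel_measurable M" and Ym: "Ys i \<in> borel_measurable M" if "i \<ge> 1" for i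
    using measurable_compose[OF pair[OF that] measurable_fst]
      measurable_compose[OF pair[OF that] measurable_snd] by simp_all
  have pair0: "(\<lambda>\<omega>. (X \<omega>, Y \<omega>)) \<in> measurable M (borel \<Otimes>\<^sub>M borel)"
    using assms(2,3) by measurable
  \<comment> \<open>Sample and population share the distribution \<open>P\<close>; the bound on the covariates is known
    for the sample and is carried over to \<open>P\<close>.\<close>
  define P where "P = distr M borel X"
  have law: "distr M borel (Xs i) = P" if "i \<ge> 1" for i
  proof -
    have "distr M borel (Xs i) = distr (distr M (borel \<Otimes>\<^sub>M borel) (\<lambda>\<omega>. (Xs i \<omega>, Ys i \<omega>))) borel fst"
      by (subst distr_distr[OF measurable_fst pair[OF that]]) (simp add: comp_def)
    also have "\<dots> = distr (distr M (borel \<Otimes>\<^sub>M borel) (\<lambda>\<omega>. (X \<omega>, Y \<omega>))) borel fst"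
      by (simp only: assms(5)[OF that])
    also have "\<dots> = P"
      unfolding P_def by (subst distr_distr[OF measurable_fst pair0]) (simp add: comp_def)
    finally show ?thesis .
  qed
  have x_bound: "norm (Xs i \<omega>) \<le> M_X" if "i \<ge> 1" "\<omega> \<in> space M" for i \<omega>
    using assms(7,17) that by blast
  have "bounded_law P M_X"
  proof -
    have "prob_space P" unfolding P_def by (rule prob_space_distr[OF assms(2)])
    moreover have "AE z in P. norm z \<le> M_X"
      unfolding law[OF order_refl, symmetric]
      by (subst AE_distr_iff) (use Xm x_bound in auto)
    ultimately show ?thesis
      unfolding bounded_law_def bounded_law_axioms_def by (simp add: P_def)
  qed
  then interpret P: bounded_law P M_X .
  obtain r where r: "\<And>u. u \<in> U \<Longrightarrow> norm u \<le> r"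
    using \<open>bounded U\<close> unfolding bounded_iff by blast
  have prior: "bounded_law prior r"
    unfolding bounded_law_def bounded_law_axioms_def
    using assms(11,12,14) r by (auto elim!: eventually_mono)

  \<comment> \<open>The residual \<open>e\<close> agrees with the noise on \<open>space M\<close>, and it is a function of the observed pair, so it
    inherits independence across \<open>i\<close> jointly with the covariate.\<close>
  define e where "e i \<omega> = Ys i \<omega> - Xs i \<omega> \<bullet> u0" for i \<omega>
  have e: "e i \<omega> = eps i \<omega>" if "i \<ge> 1" "\<omega> \<in> space M" for i \<omega>
    using assms(6)[OF that] by (simp add: e_def)
  have k: "k \<ge> 3"
  proof -
    have "1 \<le> real CARD('d)" by (simp add: Suc_le_eq)
    then show ?thesis using assms(18) by linarith
  qed
  define \<sigma>2 where "\<sigma>2 = (\<integral>t. student_t_density k t * t\<^sup>2 \<partial>lborel)"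
  have eps2: "integrable M (\<lambda>\<omega>. (eps i \<omega>)\<^sup>2)" "expectation (\<lambda>\<omega>. (eps i \<omega>)\<^sup>2) = \<sigma>2"
    and eps0: "expectation (eps i) = 0" if i: "i \<ge> 1" for i
  proof -
    have nonneg: "0 \<le> student_t_density k t" for t
      using k by (intro student_t_density_nonneg) simp
    show "integrable M (\<lambda>\<omega>. (eps i \<omega>)\<^sup>2)"
      by (subst distributed_integrable[OF assms(9)[OF i], of "\<lambda>t. t\<^sup>2", symmetric])
         (auto simp: nonneg student_t_second_moment[OF k])
    show "expectation (\<lambda>\<omega>. (eps i \<omega>)\<^sup>2) = \<sigma>2"
      unfolding \<sigma>2_def
      by (subst distributed_integral[OF assms(9)[OF i], of "\<lambda>t. t\<^sup>2", symmetric]) (auto simp: nonneg)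
    show "expectation (eps i) = 0"
      using distributed_integral[OF assms(9)[OF i], of "\<lambda>t. t"] nonneg
      by (simp add: student_t_mean_zero)
  qed
  have epsm: "eps i \<in> borel_measurable M" if "i \<ge> 1" for i
    using assms(8) that by (auto simp: indep_vars_def)
  have eps1: "integrable M (eps i)" if "i \<ge> 1" for i
    using square_integrable_imp_integrable[OF epsm eps2(1)] that by blast
  have X1: "integrable M (\<lambda>\<omega>. Xs i \<omega> \<bullet> a)" if "i \<ge> 1" for i a
  proof (rule integrable_const_bound[where B = "M_X * norm a"])
    show "AE \<omega> in M. norm (Xs i \<omega> \<bullet> a) \<le> M_X * norm a"
    proof (rule AE_I2)
      fix \<omega> assume "\<omega> \<in> space M"
      then show "norm (Xs i \<omega> \<bullet> a) \<le> M_X * norm a"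
        using Cauchy_Schwarz_ineq2[of "Xs i \<omega>" a]
          mult_right_mono[OF x_bound[OF that], of \<omega> "norm a"] by simp
    qed
  qed (use Xm[OF that] in measurable)
  have uncorrelated: "integrable M (\<lambda>\<omega>. (Xs i \<omega> \<bullet> a) * eps i \<omega>)"
      "expectation (\<lambda>\<omega>. (Xs i \<omega> \<bullet> a) * eps i \<omega>) = 0" if i: "i \<ge> 1" for i a
  proof -
    have ind: "indep_var borel (\<lambda>\<omega>. Xs i \<omega> \<bullet> a) borel (eps i)"
      by (rule indep_rvs_compose[OF assms(10)[OF i]]) measurable
    show "integrable M (\<lambda>\<omega>. (Xs i \<omega> \<bullet> a) * eps i \<omega>)"
      by (rule indep_var_integrable[OF ind X1[OF i] eps1[OF i]])
    show "expectation (\<lambda>\<omega>. (Xs i \<omega> \<bullet> a) * eps i \<omega>) = 0"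
      using indep_var_lebesgue_integral[OF ind X1[OF i] eps1[OF i]] eps0[OF i] by simp
  qed

  have risk: "risk M X Y u = \<sigma>2 + second_moment_form P (u - u0)" for u
  proof -
    define g where "g z = sq_loss (snd z) (fst z) u" for z
    have gm: "g \<in> borel_measurable (borel \<Otimes>\<^sub>M borel)"
      unfolding g_def sq_loss_def by measurable
    have "risk M X Y u = (\<integral>z. g z \<partial>distr M (borel \<Otimes>\<^sub>M borel) (\<lambda>\<omega>. (X \<omega>, Y \<omega>)))"
      by (subst integral_distr[OF pair0 gm]) (simp add: risk_def g_def)
    also have "\<dots> = (\<integral>z. g z \<partial>distr M (borel \<Otimes>\<^sub>M borel) (\<lambda>\<omega>. (Xs 1 \<omega>, Ys 1 \<omega>)))"
      by (simp only: assms(5)[OF order_refl])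
    also have "\<dots> = expectation (\<lambda>\<omega>. g (Xs 1 \<omega>, Ys 1 \<omega>))"
      by (rule integral_distr[OF pair[OF order_refl] gm])
    also have "\<dots> = expectation (\<lambda>\<omega>. (eps 1 \<omega>)\<^sup>2 - 2 * ((Xs 1 \<omega> \<bullet> (u - u0)) * eps 1 \<omega>)
        + (Xs 1 \<omega> \<bullet> (u - u0))\<^sup>2)"
      by (intro Bochner_Integration.integral_cong refl)
         (simp add: g_def sq_loss_def assms(6) inner_diff_right power2_eq_square algebra_simps)
    also have "\<dots> = \<sigma>2 + expectation (\<lambda>\<omega>. (Xs 1 \<omega> \<bullet> (u - u0))\<^sup>2)"
    proof -
      have "integrable M (\<lambda>\<omega>. (Xs 1 \<omega> \<bullet> (u - u0))\<^sup>2)"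
        using P.integrable_inner_square[of "u - u0"]
        unfolding law[OF order_refl, symmetric] by (simp add: integrable_distr_eq Xm)
      then show ?thesis
        using eps2[of 1] uncorrelated[of 1 "u - u0"] by simp
    qed
    also have "expectation (\<lambda>\<omega>. (Xs 1 \<omega> \<bullet> (u - u0))\<^sup>2) = second_moment_form P (u - u0)"
      unfolding second_moment_form_def law[OF order_refl, symmetric]
      by (simp add: integral_distr Xm)
    finally show ?thesis .
  qed

  have u0_min: "\<forall>v\<in>U. risk M X Y u0 \<le> risk M X Y v"
    unfolding risk by (simp add: P.second_moment_form_nonneg) (simp add: second_moment_form_def)
  obtain C1 C2 where C12: "C1 > 0" "C2 > 0" and
    small_ball: "\<And>\<epsilon>. \<epsilon> > 0 \<Longrightarrow> C1 * exp (- C2 * \<epsilon> powr (- \<kappa>)) \<le> measure prior (ball u0 \<epsilon>)"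
    using assms(20) u0_min \<open>u0 \<in> U\<close> unfolding regular_prior_def by blast
  obtain p c where c: "c > 0" and AEp: "AE z in P. \<forall>v. z \<bullet> p v = z \<bullet> v"
    and p: "\<And>v. (norm (p v))\<^sup>2 \<le> c * second_moment_form P v"
    using P.coercive_modulo_kernel by blast
  have AEpi: "AE \<omega> in M. \<forall>v. Xs i \<omega> \<bullet> p v = Xs i \<omega> \<bullet> v" if "i \<ge> 1" for i
    using AEp unfolding law[OF that, symmetric] by (rule AE_distrD[OF Xm[OF that]])

  have ind_e: "indep_vars (\<lambda>_. borel \<Otimes>\<^sub>M borel) (\<lambda>i \<omega>. (Xs i \<omega>, e i \<omega>)) {1..}"
    using indep_vars_compose2[OF assms(4), of "\<lambda>_ (x, y). (x, y - x \<bullet> u0)" "\<lambda>_. borel \<Otimes>\<^sub>M borel"]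
    by (auto simp: e_def[abs_def])
  obtain C where C: "C \<ge> 0"
    and fl_int: "\<And>n. integrable M (\<lambda>\<omega>. fluctuation P (\<lambda>i. Xs i \<omega>) (\<lambda>i. e i \<omega>) n)"
    and fl_le: "\<And>n. expectation (\<lambda>\<omega>. fluctuation P (\<lambda>i. Xs i \<omega>) (\<lambda>i. e i \<omega>) n) \<le> real n * C"
  proof (rule expected_fluctuation[OF P.bounded_law_axioms ind_e law, of \<sigma>2])
    fix i :: nat and a assume i: "i \<ge> 1"
    show "integrable M (\<lambda>\<omega>. (e i \<omega>)\<^sup>2)"
      using eps2(1)[OF i] e[OF i] by (simp cong: Bochner_Integration.integrable_cong)
    show "expectation (\<lambda>\<omega>. (e i \<omega>)\<^sup>2) \<le> \<sigma>2"
      using eps2(2)[OF i] e[OF i] by (simp cong: Bochner_Integration.integral_cong)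
    show "expectation (\<lambda>\<omega>. e i \<omega> * (Xs i \<omega> \<bullet> a)) = 0"
      using uncorrelated(2)[OF i, of a] e[OF i]
      by (simp add: mult.commute cong: Bochner_Integration.integral_cong)
  next
    fix C assume "C \<ge> 0"
      and "\<And>n. integrable M (\<lambda>\<omega>. fluctuation P (\<lambda>i. Xs i \<omega>) (\<lambda>i. e i \<omega>) n)"
      and "\<And>n. expectation (\<lambda>\<omega>. fluctuation P (\<lambda>i. Xs i \<omega>) (\<lambda>i. e i \<omega>) n) \<le> real n * C"
    then show thesis by (rule that)
  qed

  \<comment> \<open>Markov's inequality at level \<open>n C'\<close> leaves probability at most \<open>\<delta>\<close> for the bad event; the
    summand \<open>1\<close> keeps the level positive when \<open>C = 0\<close>.\<close>
  define C' where "C' = (C + 1) / \<delta>"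
  define A where "A = C' * c"
  define c' where "c' = 8 * (4 * A + 1 + \<bar>ln C1\<bar> + C2 + M_X\<^sup>2)"
  have C': "C' > 0" using C \<delta> by (simp add: C'_def)
  have A: "A \<ge> 0" using C' c by (simp add: A_def)
  have c': "c' > 0" using A C12 by (simp add: c'_def add_nonneg_pos add_pos_nonneg)
  obtain N0 :: nat where N0: "(2 * (real DIM(real ^ 'd))\<^sup>2 * c * sqrt C')\<^sup>2 \<le> real N0"
    using real_arch_simple by blast
  define N where "N = max 1 N0"

  have "measure M {\<omega> \<in> space M.
      risk M X Y (posterior_mean prior (\<lambda>i. Xs i \<omega>) (\<lambda>i. Ys i \<omega>) n)
        \<le> risk M X Y u0 + c' * real n powr (- \<beta>)} \<ge> 1 - \<delta>" (is "1 - \<delta> \<le> measure M ?good")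
    if nN: "n \<ge> N" for n
  proof -
    define F where "F \<omega> = fluctuation P (\<lambda>i. Xs i \<omega>) (\<lambda>i. e i \<omega>) n" for \<omega>
    have n: "n \<ge> 1" and n_large: "2 * (real DIM(real ^ 'd))\<^sup>2 * c * sqrt C' \<le> sqrt (real n)"
    proof -
      show "n \<ge> 1" using nN by (simp add: N_def)
      have "(2 * (real DIM(real ^ 'd))\<^sup>2 * c * sqrt C')\<^sup>2 \<le> real n"
        using N0 nN by (simp add: N_def)
      then show "2 * (real DIM(real ^ 'd))\<^sup>2 * c * sqrt C' \<le> sqrt (real n)"
        by (rule real_le_rsqrt)
    qed
    have F_int: "integrable M F" using fl_int[of n] by (simp add: F_def[abs_def])
    then have [measurable]: "F \<in> borel_measurable M" by auto
    have F_nonneg: "F \<omega> \<ge> 0" for \<omega> by (simp add: F_def fluctuation_def sum_nonneg)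
    have bad: "measure M {\<omega> \<in> space M. F \<omega> \<ge> real n * C'} \<le> \<delta>"
    proof -
      have "measure M {\<omega> \<in> space M. F \<omega> \<ge> real n * C'} \<le> expectation F / (real n * C')"
        using n C' F_int F_nonneg by (intro integral_Markov_inequality_measure[where A = "{}"]) auto
      also have "\<dots> \<le> (real n * C) / (real n * C')"
        using fl_le[of n] n C' by (intro divide_right_mono) (auto simp: F_def[abs_def])
      also have "\<dots> = C * \<delta> / (C + 1)" using n by (simp add: C'_def)
      also have "\<dots> \<le> \<delta>" using C \<delta> by (simp add: field_simps)
      finally show ?thesis .
    qed
    \<comment> \<open>By the risk formula the event only involves a continuous function of the posterior mean.\<close>
    have good_meas: "?good \<in> events"
    proof -
      have [measurable]: "(\<lambda>\<omega>. posterior_mean prior (\<lambda>i. Xs i \<omega>) (\<lambda>i. Ys i \<omega>) n) \<in> borel_measurable M"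
        by (rule borel_measurable_posterior_mean[OF prior Xm Ym])
      have [measurable]: "second_moment_form P \<in> borel_measurable borel"
        by (intro borel_measurable_continuous_onI P.continuous_second_moment_form)
      show ?thesis unfolding risk by measurable
    qed
    have "AE \<omega> in M. \<forall>i\<in>{1..n}. \<forall>v. Xs i \<omega> \<bullet> p v = Xs i \<omega> \<bullet> v"
      using AEpi by (intro AE_finite_allI) auto
    \<comment> \<open>Off a null set, small fluctuation implies the rate; \<open>\<epsilon>\<close> is the radius of the small ball.\<close>
    then have "AE \<omega> in M. \<omega> \<in> {\<omega> \<in> space M. F \<omega> < real n * C'} \<longrightarrow> \<omega> \<in> ?good"
    proof eventually_elim
      case (elim \<omega>)
      show ?case
      proof
        assume "\<omega> \<in> {\<omega> \<in> space M. F \<omega> < real n * C'}"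
        then have \<omega>: "\<omega> \<in> space M" and "F \<omega> \<le> real n * C'" by auto
        note bounds = P.design_and_noise_bounds[OF c p AEp, where x = "\<lambda>i. Xs i \<omega>" and e = "\<lambda>i. e i \<omega>",
            OF elim[rule_format] \<open>F \<omega> \<le> real n * C'\<close>[unfolded F_def] less_imp_le[OF C'] n_large]
        define \<epsilon> where "\<epsilon> = real n powr (- \<beta> / 2)"
        have \<epsilon>: "\<epsilon> > 0" using n by (simp add: \<epsilon>_def)
        have "second_moment_form P (posterior_mean prior (\<lambda>i. Xs i \<omega>) (\<lambda>i. Ys i \<omega>) n - u0)
            \<le> 8 / real n * (4 * A + 1 - ln (C1 * exp (- C2 * \<epsilon> powr (- \<kappa>))) + real n * (M_X * \<epsilon>)\<^sup>2)"
          unfolding posterior_mean_def posterior_eq_tilted[of prior _ _ n u0] e_def[symmetric]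
          using x_bound \<omega> C12
          by (intro P.tilted_mean_bound[OF prior n A _ _ bounds(1) bounds(2)[folded A_def] small_ball[OF \<epsilon>] \<epsilon>])
             auto
        also have "\<dots> \<le> c' * real n powr (- \<beta>)"
          unfolding \<epsilon>_def c'_def using n assms(19,21,22) C12 A by (intro rate_arithmetic) auto
        finally show "\<omega> \<in> ?good" using \<omega> by (simp add: risk second_moment_form_def)
      qed
    qed
    then have "measure M {\<omega> \<in> space M. F \<omega> < real n * C'} \<le> measure M ?good"
      by (rule finite_measure_mono_AE[OF _ good_meas])
    moreover have "measure M {\<omega> \<in> space M. F \<omega> < real n * C'}
        = 1 - measure M {\<omega> \<in> space M. F \<omega> \<ge> real n * C'}"
      by (subst prob_compl[symmetric]) (auto intro!: arg_cong[where f = "measure M"])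
    ultimately show ?thesis using bad by linarith
  qed
  then show "\<exists>c>0. \<exists>N::nat>0. \<forall>n\<ge>N.
    measure M {\<omega> \<in> space M.
      risk M X Y (posterior_mean prior (\<lambda>i. Xs i \<omega>) (\<lambda>i. Ys i \<omega>) n)
        \<le> risk M X Y u0 + c * real n powr (- \<beta>)} \<ge> 1 - \<delta>"
    using c' by (intro exI[of _ c'] conjI exI[of _ N]) (auto simp: N_def)
qed

end
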